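(* Let $M_0$ and $M_1$ be two models for the data, $M_0$ nested in $M_1$, and let $\mathbf{X}(l)$ be a (random) training sample having density $f_i(\mathbf{x}(l)\mid\boldsymbol{\theta}_i)$ under $M_i$, $i=0,1$. Let $\mathcal{X}^{\mathrm{I}}$ be the chosen sampling space of proper training samples. Suppose that (i) (Assumption 0) $P_{\boldsymbol{\theta}_i}^{M_i}(\mathbf{X}(l)\in\mathcal{X}^{\mathrm{I}})=1$ for $i=0,1$ (for all values of $\boldsymbol{\theta}_i$ in the parameter space of $M_i$); (ii) $M_0$ is a simple model, i.e. $\boldsymbol{\theta}_0$ is a specified value; (iii) the intrinsic prior is given by $$\pi_1^{\mathrm{I}}(\boldsymbol{\theta}_1)=\pi_1^{\mathrm{N}}(\boldsymbol{\theta}_1)\,E_{\boldsymbol{\theta}_1}^{M_1}\bigl[B_{01}^{\mathrm{N}}(\mathbf{X}(l))\,\big|\,\mathcal{X}^{\mathrm{I}}\bigr].$$ Then $$\int \pi_1^{\mathrm{I}}(\boldsymbol{\theta}_1)\,d\boldsymbol{\theta}_1=1 .$$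
   Context: Model $M_i$ ($i=0,1$) states that the data have density $f_i(\cdot\mid\boldsymbol{\theta}_i)$ with parameter $\boldsymbol{\theta}_i$ (densities with respect to a common dominating $\sigma$-finite measure, written $d\mathbf{x}(l)$ for training samples). $\pi_i^{\mathrm{N}}(\boldsymbol{\theta}_i)$ is a noninformative (possibly improper, nonnegative) prior density for $\boldsymbol{\theta}_i$. For a training sample $\mathbf{x}(l)$ (a subset of the data, or of hypothetical data from the models), put $$m_i^{\mathrm{N}}(\mathbf{x}(l))=\int f_i(\mathbf{x}(l)\mid\boldsymbol{\theta}_i)\,\pi_i^{\mathrm{N}}(\boldsymbol{\theta}_i)\,d\boldsymbol{\theta}_i,\qquad B_{01}^{\mathrm{N}}(\mathbf{x}(l))=\frac{m_0^{\mathrm{N}}(\mathbf{x}(l))}{m_1^{\mathrm{N}}(\mathbf{x}(l))}.$$ If $M_0$ is simple (with $\boldsymbol{\theta}_0$ specified), the prior under $M_0$ is the point mass at $\boldsymbol{\theta}_0$, so $m_0^{\mathrm{N}}(\mathbf{x}(l))=f_0(\mathbf{x}(l)\mid\boldsymbol{\theta}_0)$. A training sample $\mathbf{x}(l)$ is called proper if $0<m_i^{\mathrm{N}}(\mathbf{x}(l))<\infty$ for every model $M_i$ under consideration. The sampling space $\mathcal{X}^{\mathrm{I}}$ is a (measurable) set consisting only of proper training samples. $P_{\boldsymbol{\theta}_i}^{M_i}$ denotes probability under model $M_i$ with parameter $\boldsymbol{\theta}_i$, and $E_{\boldsymbol{\theta}_1}^{M_1}[\,\cdot\mid\mathcal{X}^{\mathrm{I}}]$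 denotes expectation over $\mathbf{X}(l)$ under model $M_1$ with parameter $\boldsymbol{\theta}_1$, conditional on the event $\mathbf{X}(l)\in\mathcal{X}^{\mathrm{I}}$. *)

theory Defs
  imports "HOL-Probability.Probability"
begin

text \<open>
  The parameter space of a model is the space of the measure \<open>param\<close>, and integration against
  \<open>param\<close> is the integral \<open>d\<theta>\<close> (e.g. \<open>restrict_space lborel \<Theta>\<close> for a Borel \<open>\<Theta>\<close> in a Euclidean space).
  \<open>law \<theta>\<close> is the probability measure of the model with parameter \<open>\<theta>\<close> on the data space,
  \<open>lik \<theta>\<close> the density of the training sample, and \<open>prior\<close> the noninformative prior
  density with respect to \<open>param\<close>.
\<close>

record ('w, 'x, 'p) bayes_model =
  param :: "'p measure"
  law :: "'p \<Rightarrow> 'w measure"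
  lik :: "'p \<Rightarrow> 'x \<Rightarrow> real"
  prior :: "'p \<Rightarrow> real"

text \<open>
  \<open>D\<close> carries only the data space and its \<open>\<sigma>\<close>-algebra; its values are irrelevant. \<open>\<mu>\<close> is the
  measure dominating the distributions of the training sample \<open>X\<close>. The prior may be improper: its
  total mass is unrestricted.
\<close>

definition valid_model ::
  "'w measure \<Rightarrow> 'x measure \<Rightarrow> ('w \<Rightarrow> 'x) \<Rightarrow> ('w, 'x, 'p) bayes_model \<Rightarrow> bool" where
  "valid_model D \<mu> X M \<longleftrightarrow>
     sigma_finite_measure (param M) \<and>
     prior M \<in> borel_measurable (param M) \<and>
     (\<forall>\<theta>\<in>space (param M). 0 \<le> prior M \<theta>) \<and>
     (\<lambda>(\<theta>, x). lik M \<theta> x) \<in> borel_measurable (param M \<Otimes>\<^sub>M \<mu>) \<and>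
     (\<forall>\<theta>\<in>space (param M). \<forall>x\<in>space \<mu>. 0 \<le> lik M \<theta> x) \<and>
     (\<forall>\<theta>\<in>space (param M). prob_space (law M \<theta>) \<and> sets (law M \<theta>) = sets D \<and>
        distributed (law M \<theta>) \<mu> X (\<lambda>x. ennreal (lik M \<theta> x)))"

definition nested_in :: "('w, 'x, 'p) bayes_model \<Rightarrow> ('w, 'y, 'q) bayes_model \<Rightarrow> bool" where
  "nested_in M0 M1 \<longleftrightarrow> law M0 ` space (param M0) \<subseteq> law M1 ` space (param M1)"

text \<open>
  In a simple model the prior distribution is the point mass at the only parameter value; relative
  to \<open>param\<close> it is the measure with density \<open>prior\<close>.
\<close>

definition simple_model :: "('w, 'x, 'p) bayes_model \<Rightarrow> 'p \<Rightarrow> bool" where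
  "simple_model M \<theta>0 \<longleftrightarrow>
     space (param M) = {\<theta>0} \<and>
     density (param M) (\<lambda>\<theta>. ennreal (prior M \<theta>)) = return (param M) \<theta>0"

definition marginal :: "('w, 'x, 'p) bayes_model \<Rightarrow> 'x \<Rightarrow> ennreal" where
  "marginal M x = (\<integral>\<^sup>+\<theta>. ennreal (lik M \<theta> x * prior M \<theta>) \<partial>param M)"

lemma marginal_simple:
  assumes "valid_model D \<mu> X M" "simple_model M \<theta>0" "x \<in> space \<mu>"
  shows "marginal M x = ennreal (lik M \<theta>0 x)"
proof -
  have [measurable]: "prior M \<in> borel_measurable (param M)"
    and l: "(\<lambda>(\<theta>, x). lik M \<theta> x) \<in> borel_measurable (param M \<Otimes>\<^sub>M \<mu>)"
    and nn: "\<And>\<theta>. \<theta> \<in> space (param M) \<Longrightarrow> 0 \<le> prior M \<theta>"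
    using assms(1) unfolding valid_model_def by auto
  have [measurable]: "(\<lambda>\<theta>. lik M \<theta> x) \<in> borel_measurable (param M)"
    using measurable_compose[OF measurable_Pair2'[OF assms(3)] l] by simp
  have "marginal M x = (\<integral>\<^sup>+\<theta>. ennreal (prior M \<theta>) * ennreal (lik M \<theta> x) \<partial>param M)"
    unfolding marginal_def
    by (intro nn_integral_cong) (simp add: ennreal_mult'' ennreal_mult' nn mult.commute)
  also have "\<dots> = (\<integral>\<^sup>+\<theta>. ennreal (lik M \<theta> x) \<partial>density (param M) (\<lambda>\<theta>. ennreal (prior M \<theta>)))"
    by (subst nn_integral_density) auto
  also have "\<dots> = ennreal (lik M \<theta>0 x)"
    using assms(2) unfolding simple_model_def by (simp add: nn_integral_return)
  finally show ?thesis .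
qed

text \<open>
  The conventions of \<open>ennreal\<close> for division by \<open>0\<close> or \<open>\<infinity>\<close> and for \<open>\<infinity> / \<infinity>\<close> only matter at training
  samples that are not proper.
\<close>

definition bayes_factor ::
  "('w, 'x, 'p) bayes_model \<Rightarrow> ('w, 'x, 'q) bayes_model \<Rightarrow> 'x \<Rightarrow> ennreal" where
  "bayes_factor M0 M1 x = marginal M0 x / marginal M1 x"

definition proper_sample ::
  "('w, 'x, 'p) bayes_model \<Rightarrow> ('w, 'x, 'q) bayes_model \<Rightarrow> 'x \<Rightarrow> bool" where
  "proper_sample M0 M1 x \<longleftrightarrow>
     0 < marginal M0 x \<and> marginal M0 x < \<infinity> \<and> 0 < marginal M1 x \<and> marginal M1 x < \<infinity>"

definition sampling_space ::
  "'x measure \<Rightarrow> ('w, 'x, 'p) bayes_model \<Rightarrow> ('w, 'x, 'q) bayes_model \<Rightarrow> 'x set \<Rightarrow> bool" where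
  "sampling_space \<mu> M0 M1 XI \<longleftrightarrow> XI \<in> sets \<mu> \<and> (\<forall>x\<in>XI. proper_sample M0 M1 x)"

definition sample_event :: "'w measure \<Rightarrow> ('w \<Rightarrow> 'x) \<Rightarrow> 'x set \<Rightarrow> 'w set" where
  "sample_event P X XI = {\<omega>\<in>space P. X \<omega> \<in> XI}"

text \<open>
  Conditional expectation of a nonnegative function of the training sample given the event that the
  sample lies in \<open>XI\<close>: \<open>uniform_measure P A\<close> is the conditional probability \<open>B \<mapsto> P (A \<inter> B) / P A\<close>.
\<close>

definition cond_expectation ::
  "'w measure \<Rightarrow> ('w \<Rightarrow> 'x) \<Rightarrow> 'x set \<Rightarrow> ('x \<Rightarrow> ennreal) \<Rightarrow> ennreal" where
  "cond_expectation P X XI g = (\<integral>\<^sup>+\<omega>. g (X \<omega>) \<partial>uniform_measure P (sample_event P X XI))"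

definition intrinsic_prior ::
  "('w \<Rightarrow> 'x) \<Rightarrow> 'x set \<Rightarrow> ('w, 'x, 'p) bayes_model \<Rightarrow> ('w, 'x, 'q) bayes_model \<Rightarrow> 'q \<Rightarrow> ennreal" where
  "intrinsic_prior X XI M0 M1 \<theta>1 =
     ennreal (prior M1 \<theta>1) * cond_expectation (law M1 \<theta>1) X XI (bayes_factor M0 M1)"

end

theory Submission
  imports Defs
begin

text \<open>
  Under Assumption 0 the conditioning event has probability one, so the expected Bayes factor at
  \<open>\<theta>\<^sub>1\<close> is the integral of \<open>m\<^sub>0 / m\<^sub>1\<close> against the density \<open>lik M1 \<theta>\<^sub>1\<close> over \<open>XI\<close>
  (lemma \<open>cond_expectation_eq_nn_integral\<close>). Averaging over \<open>\<theta>\<^sub>1\<close> with the noninformative prior and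
  exchanging the integrals (Tonelli, lemma \<open>nn_integral_prior_likelihood\<close>) turns that density into
  \<open>m\<^sub>1\<close>, which cancels the denominator because \<open>XI\<close> contains only proper samples. Hence the total
  mass of the intrinsic prior is the integral of \<open>m\<^sub>0\<close> over \<open>XI\<close>
  (lemma \<open>nn_integral_intrinsic_prior\<close>). When \<open>M0\<close> is simple, \<open>m\<^sub>0\<close> is the density of the sample
  under \<open>\<theta>\<^sub>0\<close>, and this integral is the probability of \<open>XI\<close> under \<open>M0\<close>, namely one.
\<close>

lemma measurable_prior_likelihood:
  assumes "valid_model D \<mu> X M"
  shows "(\<lambda>(x, \<theta>). ennreal (lik M \<theta> x * prior M \<theta>)) \<in> borel_measurable (\<mu> \<Otimes>\<^sub>M param M)"
proof -
  have [measurable]: "prior M \<in> borel_measurable (param M)"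
    and l: "(\<lambda>(\<theta>, x). lik M \<theta> x) \<in> borel_measurable (param M \<Otimes>\<^sub>M \<mu>)"
    using assms unfolding valid_model_def by auto
  have [measurable]: "(\<lambda>(x, \<theta>). lik M \<theta> x) \<in> borel_measurable (\<mu> \<Otimes>\<^sub>M param M)"
    using measurable_pair_swap[OF l] by (simp add: split_beta')
  show ?thesis by measurable
qed

lemma measurable_marginal:
  assumes "valid_model D \<mu> X M"
  shows "marginal M \<in> borel_measurable \<mu>"
proof -
  interpret sigma_finite_measure "param M" using assms unfolding valid_model_def by auto
  show ?thesis
    unfolding marginal_def[abs_def]
    by (rule borel_measurable_nn_integral[OF measurable_prior_likelihood[OF assms]])
qed

lemma measurable_bayes_factor:
  assumes "valid_model D \<mu> X M0" "valid_model D \<mu> X M1"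
  shows "bayes_factor M0 M1 \<in> borel_measurable \<mu>"
  using measurable_marginal[OF assms(1)] measurable_marginal[OF assms(2)]
  unfolding bayes_factor_def[abs_def] by simp

text \<open>Conditioning on an almost sure event changes the expectation only by restricting it there.\<close>

lemma cond_expectation_eq_nn_integral:
  assumes dist: "distributed P \<mu> X f" and g: "g \<in> borel_measurable \<mu>" and A: "A \<in> sets \<mu>"
    and one: "measure P (sample_event P X A) = 1"
  shows "cond_expectation P X A g = (\<integral>\<^sup>+x. f x * (g x * indicator A x) \<partial>\<mu>)"
proof -
  note [measurable] = g A distributed_measurable[OF dist]
  have S: "sample_event P X A \<in> sets P"
    unfolding sample_event_def by measurable
  \<comment> \<open>a set of infinite measure would have real measure \<open>0\<close>\<close>
  have "emeasure P (sample_event P X A) \<noteq> \<infinity>"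
    using one by (auto simp: measure_def)
  then have "emeasure P (sample_event P X A) = 1"
    using one by (simp add: emeasure_eq_ennreal_measure)
  then have "cond_expectation P X A g = (\<integral>\<^sup>+\<omega>. g (X \<omega>) * indicator (sample_event P X A) \<omega> \<partial>P)"
    unfolding cond_expectation_def
    by (subst nn_integral_uniform_measure) (use S in \<open>auto simp: divide_ennreal_def\<close>)
  also have "\<dots> = (\<integral>\<^sup>+\<omega>. g (X \<omega>) * indicator A (X \<omega>) \<partial>P)"
    by (intro nn_integral_cong) (auto simp: sample_event_def indicator_def)
  also have "\<dots> = (\<integral>\<^sup>+x. f x * (g x * indicator A x) \<partial>\<mu>)"
    by (subst distributed_nn_integral[OF dist]) auto
  finally show ?thesis .
qed

text \<open>
  Tonelli's theorem: \<open>marginal M\<close> is the density of the sample under the mixture of the model over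
  its prior, and this remains true when the prior is improper.
\<close>

lemma nn_integral_prior_likelihood:
  assumes \<mu>: "sigma_finite_measure \<mu>" and M: "valid_model D \<mu> X M"
    and h[measurable]: "h \<in> borel_measurable \<mu>"
  shows "(\<integral>\<^sup>+\<theta>. ennreal (prior M \<theta>) * (\<integral>\<^sup>+x. ennreal (lik M \<theta> x) * h x \<partial>\<mu>) \<partial>param M)
       = (\<integral>\<^sup>+x. marginal M x * h x \<partial>\<mu>)"
proof -
  interpret P: sigma_finite_measure "param M" using M unfolding valid_model_def by auto
  interpret \<mu>: sigma_finite_measure \<mu> by (rule \<mu>)
  interpret pair_sigma_finite \<mu> "param M" ..
  have l: "(\<lambda>(\<theta>, x). lik M \<theta> x) \<in> borel_measurable (param M \<Otimes>\<^sub>M \<mu>)"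
    and nn: "\<And>\<theta>. \<theta> \<in> space (param M) \<Longrightarrow> 0 \<le> prior M \<theta>"
    using M unfolding valid_model_def by auto
  note pl[measurable] = measurable_prior_likelihood[OF M]
  have "(\<integral>\<^sup>+\<theta>. ennreal (prior M \<theta>) * (\<integral>\<^sup>+x. ennreal (lik M \<theta> x) * h x \<partial>\<mu>) \<partial>param M)
      = (\<integral>\<^sup>+\<theta>. (\<integral>\<^sup>+x. ennreal (lik M \<theta> x * prior M \<theta>) * h x \<partial>\<mu>) \<partial>param M)"
  proof (intro nn_integral_cong)
    fix \<theta> assume \<theta>: "\<theta> \<in> space (param M)"
    have [measurable]: "(\<lambda>x. lik M \<theta> x) \<in> borel_measurable \<mu>"
      using measurable_compose[OF measurable_Pair1'[OF \<theta>] l] by simp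
    have "ennreal (lik M \<theta> x * prior M \<theta>) = ennreal (lik M \<theta> x) * ennreal (prior M \<theta>)" for x
      by (rule ennreal_mult''[OF nn[OF \<theta>]])
    then show "ennreal (prior M \<theta>) * (\<integral>\<^sup>+x. ennreal (lik M \<theta> x) * h x \<partial>\<mu>)
        = (\<integral>\<^sup>+x. ennreal (lik M \<theta> x * prior M \<theta>) * h x \<partial>\<mu>)"
      by (simp add: nn_integral_cmult[symmetric] mult.assoc mult.left_commute)
  qed
  also have "\<dots> = (\<integral>\<^sup>+x. (\<integral>\<^sup>+\<theta>. ennreal (lik M \<theta> x * prior M \<theta>) * h x \<partial>param M) \<partial>\<mu>)"
    by (rule Fubini') measurable
  also have "\<dots> = (\<integral>\<^sup>+x. marginal M x * h x \<partial>\<mu>)"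
    unfolding marginal_def
    by (intro nn_integral_cong nn_integral_multc) measurable
  finally show ?thesis .
qed

text \<open>
  On proper samples \<open>m\<^sub>1\<close> is positive and finite, which is what makes the cancellation
  \<open>m\<^sub>1 * (m\<^sub>0 / m\<^sub>1) = m\<^sub>0\<close> legitimate.
\<close>

lemma nn_integral_intrinsic_prior:
  assumes \<mu>: "sigma_finite_measure \<mu>"
    and M0: "valid_model D \<mu> X M0" and M1: "valid_model D \<mu> X M1"
    and XI: "sampling_space \<mu> M0 M1 XI"
    and one: "\<forall>\<theta>\<in>space (param M1). measure (law M1 \<theta>) (sample_event (law M1 \<theta>) X XI) = 1"
  shows "(\<integral>\<^sup>+\<theta>. intrinsic_prior X XI M0 M1 \<theta> \<partial>param M1)
       = (\<integral>\<^sup>+x. marginal M0 x * indicator XI x \<partial>\<mu>)"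
proof -
  have A[measurable]: "XI \<in> sets \<mu>" and proper: "\<And>x. x \<in> XI \<Longrightarrow> proper_sample M0 M1 x"
    using XI unfolding sampling_space_def by auto
  note B[measurable] = measurable_bayes_factor[OF M0 M1]
  have "(\<integral>\<^sup>+\<theta>. intrinsic_prior X XI M0 M1 \<theta> \<partial>param M1)
      = (\<integral>\<^sup>+\<theta>. ennreal (prior M1 \<theta>) *
          (\<integral>\<^sup>+x. ennreal (lik M1 \<theta> x) * (bayes_factor M0 M1 x * indicator XI x) \<partial>\<mu>) \<partial>param M1)"
  proof (intro nn_integral_cong)
    fix \<theta> assume \<theta>: "\<theta> \<in> space (param M1)"
    then have "distributed (law M1 \<theta>) \<mu> X (\<lambda>x. ennreal (lik M1 \<theta> x))"
      using M1 unfolding valid_model_def by auto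
    from cond_expectation_eq_nn_integral[OF this B A] one \<theta>
    show "intrinsic_prior X XI M0 M1 \<theta> = ennreal (prior M1 \<theta>) *
          (\<integral>\<^sup>+x. ennreal (lik M1 \<theta> x) * (bayes_factor M0 M1 x * indicator XI x) \<partial>\<mu>)"
      unfolding intrinsic_prior_def by simp
  qed
  also have "\<dots> = (\<integral>\<^sup>+x. marginal M1 x * (bayes_factor M0 M1 x * indicator XI x) \<partial>\<mu>)"
    by (rule nn_integral_prior_likelihood[OF \<mu> M1]) measurable
  also have "\<dots> = (\<integral>\<^sup>+x. marginal M0 x * indicator XI x \<partial>\<mu>)"
  proof (intro nn_integral_cong)
    fix x
    show "marginal M1 x * (bayes_factor M0 M1 x * indicator XI x) = marginal M0 x * indicator XI x"
    proof (cases "x \<in> XI")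
      case True
      then have "marginal M1 x \<noteq> 0" "marginal M1 x \<noteq> \<top>"
        using proper[OF True] unfolding proper_sample_def by auto
      then have "marginal M1 x * (marginal M0 x / marginal M1 x) = marginal M0 x"
        by (simp add: ennreal_times_divide mult_divide_eq_ennreal mult.commute)
      with True show ?thesis by (simp add: bayes_factor_def)
    qed simp
  qed
  finally show ?thesis .
qed

theorem lemma1:
  fixes D :: "'w measure" and \<mu> :: "'x measure" and X :: "'w \<Rightarrow> 'x"
    and M0 :: "('w, 'x, 'p) bayes_model" and M1 :: "('w, 'x, 'q) bayes_model"
    and \<theta>0 :: 'p and XI :: "'x set" and \<pi>1I :: "'q \<Rightarrow> ennreal"
  assumes "sigma_finite_measure \<mu>"
    and "valid_model D \<mu> X M0" and "valid_model D \<mu> X M1"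
    and "nested_in M0 M1"
    and "sampling_space \<mu> M0 M1 XI"
    and "\<forall>\<theta>\<in>space (param M0). measure (law M0 \<theta>) (sample_event (law M0 \<theta>) X XI) = 1"
    and "\<forall>\<theta>\<in>space (param M1). measure (law M1 \<theta>) (sample_event (law M1 \<theta>) X XI) = 1"
    and "simple_model M0 \<theta>0"
    and "\<forall>\<theta>1\<in>space (param M1). \<pi>1I \<theta>1 = intrinsic_prior X XI M0 M1 \<theta>1"
  shows "(\<integral>\<^sup>+\<theta>1. \<pi>1I \<theta>1 \<partial>param M1) = 1"
proof -
  have \<theta>0: "\<theta>0 \<in> space (param M0)"
    using assms(8) unfolding simple_model_def by auto
  then interpret P0: prob_space "law M0 \<theta>0"
    using assms(2) unfolding valid_model_def by auto
  have dist: "distributed (law M0 \<theta>0) \<mu> X (\<lambda>x. ennreal (lik M0 \<theta>0 x))"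
    using assms(2) \<theta>0 unfolding valid_model_def by auto
  have XI: "XI \<in> sets \<mu>"
    using assms(5) unfolding sampling_space_def by auto
  have "(\<integral>\<^sup>+\<theta>1. \<pi>1I \<theta>1 \<partial>param M1) = (\<integral>\<^sup>+\<theta>. intrinsic_prior X XI M0 M1 \<theta> \<partial>param M1)"
    using assms(9) by (intro nn_integral_cong) auto
  also have "\<dots> = (\<integral>\<^sup>+x. marginal M0 x * indicator XI x \<partial>\<mu>)"
    by (rule nn_integral_intrinsic_prior[OF assms(1,2,3,5,7)])
  also have "\<dots> = (\<integral>\<^sup>+x. ennreal (lik M0 \<theta>0 x) * indicator XI x \<partial>\<mu>)"
    using marginal_simple[OF assms(2,8)] by (intro nn_integral_cong) simp
  also have "\<dots> = emeasure (law M0 \<theta>0) (X -` XI \<inter> space (law M0 \<theta>0))"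
    by (rule distributed_emeasure[OF dist XI, symmetric])
  also have "X -` XI \<inter> space (law M0 \<theta>0) = sample_event (law M0 \<theta>0) X XI"
    unfolding sample_event_def by auto
  also have "emeasure (law M0 \<theta>0) (sample_event (law M0 \<theta>0) X XI) = 1"
    using assms(6) \<theta>0 by (simp add: P0.emeasure_eq_measure)
  finally show ?thesis .
qed

end
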